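(* Let $m \ge 2$ be an integer and let $A$ be an Artin--Tits group of type $I_2(m)$, i.e., $A$ admits the presentation $\langle \sigma_1,\sigma_2 \,;\, \sigma_1\sigma_2\sigma_1\sigma_2\cdots = \sigma_2\sigma_1\sigma_2\sigma_1\cdots\rangle$ where both sides of the equality are alternating products of length $m$. Then every nonempty word on the letters $\sigma_1^{\pm1},\sigma_2^{\pm1}$ representing $1$ in $A$ contains a removable pair of letters.
   Context: Words are finite words on the letters $\sigma_1^{\pm1},\sigma_2^{\pm1}$, not assumed to be freely reduced; $\equiv$ denotes the relation "represent the same element of $A$". A word of the form $\sigma^e w \tau^{-e}$ with $\sigma,\tau\in\{\sigma_1,\sigma_2\}$ (possibly equal), $e=\pm1$ and $w$ a possibly empty word is called a removable pair of letters if $\sigma^e w\tau^{-e}\equiv w$ holds. A word contains a removable pair of letters if some subword of it (consisting of consecutive letters) is a removable pair of letters. *)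

theory Defs
  imports "HOL-Algebra.Group" "HOL-Library.Sublist"
begin

text \<open>A letter \<open>(a, True)\<close> stands for the generator \<open>a\<close>, and \<open>(a, False)\<close> for its formal
  inverse. Words are not assumed to be freely reduced.\<close>

type_synonym 'a letter = "'a \<times> bool"
type_synonym 'a gword = "'a letter list"

inductive word_cong :: "('a gword \<times> 'a gword) set \<Rightarrow> 'a gword \<Rightarrow> 'a gword \<Rightarrow> bool"
  for R where
  refl: "word_cong R w w"
| sym: "word_cong R u v \<Longrightarrow> word_cong R v u"
| trans: "word_cong R u v \<Longrightarrow> word_cong R v w \<Longrightarrow> word_cong R u w"
| cancel: "word_cong R (u @ [(a, e), (a, \<not> e)] @ v) (u @ v)"
| relator: "(l, r) \<in> R \<Longrightarrow> word_cong R (u @ l @ v) (u @ r @ v)"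

definition word_class :: "('a gword \<times> 'a gword) set \<Rightarrow> 'a gword \<Rightarrow> 'a gword set" where
  "word_class R w = {v. word_cong R w v}"

text \<open>The group \<open>\<langle> 'a ; l = r for (l, r) \<in> R \<rangle>\<close>, with all elements of the type \<open>'a\<close> as generators.\<close>

definition presented_group :: "('a gword \<times> 'a gword) set \<Rightarrow> 'a gword set monoid" where
  "presented_group R =
    \<lparr>carrier = range (word_class R),
     mult = (\<lambda>X Y. {w. \<exists>x\<in>X. \<exists>y\<in>Y. word_cong R (x @ y) w}),
     one = word_class R []\<rparr>"

definition admits_presentation ::
    "('g, 'b) monoid_scheme \<Rightarrow> ('a \<Rightarrow> 'g) \<Rightarrow> ('a gword \<times> 'a gword) set \<Rightarrow> bool" where
  "admits_presentation G s R \<longleftrightarrow>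
    group G \<and> (\<exists>\<phi> \<in> iso (presented_group R) G. \<forall>a. \<phi> (word_class R [(a, True)]) = s a)"

fun word_value :: "('g, 'b) monoid_scheme \<Rightarrow> ('a \<Rightarrow> 'g) \<Rightarrow> 'a gword \<Rightarrow> 'g" where
  "word_value G s [] = \<one>\<^bsub>G\<^esub>"
| "word_value G s ((a, e) # w) = (if e then s a else inv\<^bsub>G\<^esub> (s a)) \<otimes>\<^bsub>G\<^esub> word_value G s w"

datatype gen = Sigma1 | Sigma2

fun alternating :: "'a \<Rightarrow> 'a \<Rightarrow> nat \<Rightarrow> 'a gword" where
  "alternating a b 0 = []"
| "alternating a b (Suc n) = (a, True) # alternating b a n"

definition artin_tits_I2 :: "nat \<Rightarrow> ('g, 'b) monoid_scheme \<Rightarrow> (gen \<Rightarrow> 'g) \<Rightarrow> bool" where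
  "artin_tits_I2 m A \<sigma> \<longleftrightarrow>
    admits_presentation A \<sigma> {(alternating Sigma1 Sigma2 m, alternating Sigma2 Sigma1 m)}"

definition removable_pair :: "('g, 'b) monoid_scheme \<Rightarrow> ('a \<Rightarrow> 'g) \<Rightarrow> 'a gword \<Rightarrow> bool" where
  "removable_pair A \<sigma> p \<longleftrightarrow>
    (\<exists>a b e w. p = [(a, e)] @ w @ [(b, \<not> e)] \<and> word_value A \<sigma> p = word_value A \<sigma> w)"

definition contains_removable_pair ::
    "('g, 'b) monoid_scheme \<Rightarrow> ('a \<Rightarrow> 'g) \<Rightarrow> 'a gword \<Rightarrow> bool" where
  "contains_removable_pair A \<sigma> w \<longleftrightarrow> (\<exists>p. sublist p w \<and> removable_pair A \<sigma> p)"

text \<open>The construction does yield a group, and this group admits its defining presentation.\<close>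

lemma word_cong_append_left: "word_cong R u v \<Longrightarrow> word_cong R (x @ u) (x @ v)"
proof (induction rule: word_cong.induct)
  case (cancel u a e v)
  show ?case using word_cong.cancel[of R "x @ u" a e v] by simp
next
  case (relator l r u v)
  then show ?case using word_cong.relator[of l r R "x @ u" v] by simp
qed (blast intro: word_cong.intros)+

lemma word_cong_append_right: "word_cong R u v \<Longrightarrow> word_cong R (u @ x) (v @ x)"
proof (induction rule: word_cong.induct)
  case (cancel u a e v)
  show ?case using word_cong.cancel[of R u a e "v @ x"] by simp
next
  case (relator l r u v)
  then show ?case using word_cong.relator[of l r R u "v @ x"] by simp
qed (blast intro: word_cong.intros)+

lemma word_cong_append:
  "word_cong R u v \<Longrightarrow> word_cong R x y \<Longrightarrow> word_cong R (u @ x) (v @ y)"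
  by (meson word_cong.trans word_cong_append_left word_cong_append_right)

lemma word_class_eq_iff: "word_class R u = word_class R v \<longleftrightarrow> word_cong R u v"
  unfolding word_class_def by (auto intro: word_cong.intros)

lemma presented_group_mult:
  "word_class R u \<otimes>\<^bsub>presented_group R\<^esub> word_class R v = word_class R (u @ v)"
proof -
  have "(\<exists>x. word_cong R u x \<and> (\<exists>y. word_cong R v y \<and> word_cong R (x @ y) w))
      \<longleftrightarrow> word_cong R (u @ v) w" for w
    by (meson word_cong.refl word_cong.trans word_cong_append)
  then show ?thesis by (auto simp: presented_group_def word_class_def)
qed

lemma word_cong_inverse:
  "word_cong R (map (\<lambda>(a, e). (a, \<not> e)) (rev w) @ w) []"
proof (induction w)
  case Nil
  show ?case by (simp add: word_cong.refl)
next
  case (Cons l w)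
  obtain a e where l: "l = (a, e)" by (cases l)
  show ?case
    using word_cong.cancel[of R "map (\<lambda>(a, e). (a, \<not> e)) (rev w)" a "\<not> e" w] Cons
    by (auto simp: l intro: word_cong.trans)
qed

lemma group_presented_group: "group (presented_group R)"
proof (rule groupI)
  let ?G = "presented_group R"
  have carr: "carrier ?G = range (word_class R)" and one: "\<one>\<^bsub>?G\<^esub> = word_class R []"
    by (simp_all add: presented_group_def)
  show "\<one>\<^bsub>?G\<^esub> \<in> carrier ?G" by (simp add: carr one)
  fix x assume x: "x \<in> carrier ?G"
  then obtain u where u: "x = word_class R u" by (auto simp: carr)
  show "\<one>\<^bsub>?G\<^esub> \<otimes>\<^bsub>?G\<^esub> x = x" by (simp add: u one presented_group_mult)
  have "word_class R (map (\<lambda>(a, e). (a, \<not> e)) (rev u)) \<otimes>\<^bsub>?G\<^esub> x = \<one>\<^bsub>?G\<^esub>"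
    by (simp add: u one presented_group_mult word_class_eq_iff word_cong_inverse)
  then show "\<exists>y\<in>carrier ?G. y \<otimes>\<^bsub>?G\<^esub> x = \<one>\<^bsub>?G\<^esub>" by (auto simp: carr)
  fix y assume "y \<in> carrier ?G"
  then obtain v where v: "y = word_class R v" by (auto simp: carr)
  show "x \<otimes>\<^bsub>?G\<^esub> y \<in> carrier ?G" by (simp add: u v carr presented_group_mult)
  fix z assume "z \<in> carrier ?G"
  then obtain w where w: "z = word_class R w" by (auto simp: carr)
  show "x \<otimes>\<^bsub>?G\<^esub> y \<otimes>\<^bsub>?G\<^esub> z = x \<otimes>\<^bsub>?G\<^esub> (y \<otimes>\<^bsub>?G\<^esub> z)"
    by (simp add: u v w presented_group_mult)
qed

lemma admits_presentation_presented_group: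
  "admits_presentation (presented_group R) (\<lambda>a. word_class R [(a, True)]) R"
  unfolding admits_presentation_def
  using group_presented_group[of R] iso_set_refl[of "presented_group R"] by auto

end

theory Submission
  imports Defs
begin

text \<open>Write \<open>\<Delta>\<close> for the common value of the two alternating words of length \<open>m\<close>. Since
  \<open>\<sigma>\<^sub>a \<Delta> = \<Delta> \<sigma>\<^sub>b\<close> with \<open>b = a\<close> for even \<open>m\<close> and \<open>b\<close> the other letter for odd \<open>m\<close>, the cosets of
  \<open>\<langle>\<Delta>\<rangle>\<close> form a graph in which a word traces a path. The \<open>m\<close> proper prefixes of an alternating word of
  length \<open>m\<close> lie on a cycle of length \<open>m\<close>, every vertex lies on exactly two such cycles, and the
  cycles are glued along their common vertices in the pattern of a tree. At each vertex, the
  letters \<open>\<sigma>\<^sub>1, \<sigma>\<^sub>2\<close> step forward along the two cycles, and \<open>\<sigma>\<^sub>1\<inverse>, \<sigma>\<^sub>2\<inverse>\<close> step backward along them.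

  The proof shows that a word without removable pair that traces a closed path has all its letters
  of the same sign (\<open>closed_removable_free_uniform\<close>). A word that represents \<open>1\<close> traces a closed
  path and has exponent sum \<open>0\<close>, so if it contained no removable pair it would be empty.

  A closed path represents a power of \<open>\<Delta>\<close> (\<open>closed_val\<close>), and commuting letters with this power
  exhibits two kinds of removable pairs. So in the absence of removable pairs a path cannot step
  along an edge of a cycle, make a closed excursion, and step back along the same edge
  (\<open>no_backtrack\<close>). Nor can a closed path that starts by a step along one cycle at a vertex be
  followed by a step of the opposite sign along the other cycle at that vertex (\<open>no_turn_across\<close>);
  the simplest instance is \<open>\<sigma>\<^sub>1 w \<tau>\<inverse> \<equiv> w\<close>, where \<open>w\<close> is the alternating word with \<open>\<sigma>\<^sub>1 w \<equiv> \<Delta>\<close> and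
  \<open>\<sigma>\<^sub>1 \<Delta> = \<Delta> \<tau>\<close>.

  Now take a closed path and the cycle \<open>C\<close> of its first step. By the tree structure, the path
  between two consecutive steps along \<open>C\<close> is a closed excursion that starts along the other cycle
  at its vertex (\<open>avoiding_excursion_closed\<close>). The first prohibition gives all steps along \<open>C\<close> the
  same sign. By induction on the length, each excursion has a constant sign, and the second
  prohibition forces this sign to be that of the steps along \<open>C\<close>: apply it to an excursion and the
  step along \<open>C\<close> after it, or, for the last excursion, to everything before it and its first
  letter.\<close>

section \<open>The two generators\<close>

fun other :: "gen \<Rightarrow> gen" where
  "other Sigma1 = Sigma2"
| "other Sigma2 = Sigma1"

definition twist :: "int \<Rightarrow> gen \<Rightarrow> gen" where
  "twist n a = (if even n then a else other a)"

lemma other_other [simp]: "other (other a) = a"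
  by (cases a) auto

lemma other_neq [simp]: "other a \<noteq> a" "a \<noteq> other a"
  by (cases a; simp)+

lemma neq_iff_other: "a \<noteq> b \<longleftrightarrow> a = other b"
  by (cases a; cases b) auto

lemma other_eq_iff: "other a = b \<longleftrightarrow> a = other b"
  by (cases a; cases b) auto

lemma twist_twist [simp]: "twist i (twist j a) = twist (i + j) a"
  by (auto simp: twist_def)

lemma twist_0 [simp]: "twist 0 a = a"
  by (simp add: twist_def)

lemma other_eq_twist: "other a = twist 1 a"
  by (simp add: twist_def)

lemma twist_cong: "even (i - j) \<Longrightarrow> twist i a = twist j a"
  by (auto simp: twist_def)

lemma same_side_twist: "(a = c) = (b = twist n c) \<Longrightarrow> b = twist n a"
  by (cases a; cases b; cases c) (auto simp: twist_def split: if_splits)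

section \<open>Words act on a tree of cycles\<close>

text \<open>A vertex is a stack of integers describing the way to it from a root cycle: the last entry
  is a position on the root cycle, and an entry \<open>i\<close> in front of the stack \<open>s\<close> means walking \<open>i\<close> steps
  along the cycle that was newly entered at the vertex \<open>s\<close>. So the nonempty stack \<open>s\<close> names a vertex
  and also the cycle hanging off this vertex, while \<open>[]\<close> names the root cycle only. The vertex \<open>t\<close>
  lies on the two cycles \<open>tl t\<close> and \<open>t\<close>.

  The letter in a state is the generator that steps forward along the cycle \<open>tl t\<close>; the other
  generator then steps forward along the cycle \<open>t\<close>. It has to be recorded because multiplication by
  \<open>\<Delta>\<close> fixes all vertices but exchanges the two generators when \<open>m\<close> is odd.\<close>
type_synonym state = "int list \<times> gen"

text \<open>Only the root cycle has a position \<open>0\<close> of its own: on any other cycle \<open>s\<close>, position \<open>0\<close> is the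
  vertex \<open>s\<close>, and excluding \<open>0 # s\<close> gives each vertex a single name.\<close>
definition valid_stack :: "nat \<Rightarrow> int list \<Rightarrow> bool" where
  "valid_stack m t \<longleftrightarrow> t \<noteq> [] \<and> (\<forall>i\<in>set t. 0 \<le> i \<and> i < int m) \<and> 0 \<notin> set (butlast t)"

text \<open>The state at position \<open>j\<close> (modulo \<open>m\<close>) of the cycle \<open>s\<close> in which \<open>c\<close> steps forward along \<open>s\<close>.
  At position \<open>0\<close> of a cycle other than the root cycle, \<open>s\<close> is the second cycle of the vertex, so
  that the letter stored in the state is the other one.\<close>
definition place :: "nat \<Rightarrow> int list \<Rightarrow> gen \<Rightarrow> int \<Rightarrow> state" where
  "place m s c j =
    (if j mod int m = 0 \<and> s \<noteq> [] then (s, other c) else ((j mod int m) # s, c))"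

definition on_cycle :: "int list \<Rightarrow> state \<Rightarrow> bool" where
  "on_cycle s x \<longleftrightarrow> fst x \<noteq> [] \<and> (fst x = s \<or> tl (fst x) = s)"

definition cycle_letter :: "int list \<Rightarrow> state \<Rightarrow> gen" where
  "cycle_letter s x = (if fst x = s then other (snd x) else snd x)"

definition position :: "int list \<Rightarrow> state \<Rightarrow> int" where
  "position s x = (if fst x = s then 0 else hd (fst x))"

text \<open>A positive letter equal to the stored letter steps forward along \<open>tl t\<close>. After a step along a
  cycle the forward letter changes, so the negative letter that undoes it is the inverse of the
  generator that is not the forward letter.\<close>
definition cycle_of :: "state \<Rightarrow> gen letter \<Rightarrow> int list" where
  "cycle_of x l = (if (fst l = snd x) = snd l then tl (fst x) else fst x)"

definition step :: "nat \<Rightarrow> state \<Rightarrow> gen letter \<Rightarrow> state" where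
  "step m x l =
    (let s = cycle_of x l
     in place m s (other (cycle_letter s x)) (position s x + (if snd l then 1 else -1)))"

definition run :: "nat \<Rightarrow> state \<Rightarrow> gen gword \<Rightarrow> state" where
  "run m = foldl (step m)"

lemma run_Nil [simp]: "run m x [] = x"
  and run_Cons [simp]: "run m x (l # w) = run m (step m x l) w"
  and run_append [simp]: "run m x (u @ v) = run m (run m x u) v"
  by (simp_all add: run_def)

lemma tl_neq [simp]: "t \<noteq> [] \<Longrightarrow> tl t \<noteq> t" "t \<noteq> [] \<Longrightarrow> t \<noteq> tl t"
  by (cases t; simp)+

lemma on_cycle_place [simp]: "on_cycle s (place m s c j)"
  by (auto simp: on_cycle_def place_def)

lemma nonempty_place [simp]: "fst (place m s c j) \<noteq> []"
  by (auto simp: place_def)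

lemma cycle_letter_place [simp]: "cycle_letter s (place m s c j) = c"
  by (auto simp: cycle_letter_def place_def)

lemma position_place: "position s (place m s c j) = j mod int m"
  by (auto simp: position_def place_def)

lemma place_mod: "place m s c (j mod int m + k) = place m s c (j + k)"
  by (simp add: place_def mod_simps)

lemma nonempty_step [simp]: "fst (step m x l) \<noteq> []"
  by (simp add: step_def Let_def)

lemma on_cycle_nonempty: "on_cycle s x \<Longrightarrow> fst x \<noteq> []"
  by (simp add: on_cycle_def)

lemma nonempty_run: "fst x \<noteq> [] \<Longrightarrow> fst (run m x w) \<noteq> []"
  by (induction w arbitrary: x) auto

lemma cycle_of_eq_iff:
  assumes "fst x \<noteq> []"
  shows "cycle_of x (a, e) = s \<longleftrightarrow> on_cycle s x \<and> (a = cycle_letter s x) = e"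
  using assms by (cases a; cases "snd x") (auto simp: cycle_of_def on_cycle_def cycle_letter_def)

text \<open>All dynamics is the uniform motion \<open>j \<mapsto> j \<plusminus> 1\<close> along a cycle, with no distinction
  whether the step pushes, pops or changes an entry of the stack. By \<open>state_as_place\<close> every step can
  be seen in this way.\<close>
lemma step_place:
  assumes "(a = c) = e"
  shows "step m (place m s c j) (a, e) = place m s (other c) (j + (if e then 1 else -1))"
proof -
  have "cycle_of (place m s c j) (a, e) = s"
    using assms by (simp add: cycle_of_eq_iff)
  then show ?thesis
    by (simp add: step_def position_place place_mod place_mod[of _ _ _ _ "-1", simplified])
qed

lemma place_cycle_view:
  assumes "valid_stack m (fst x)" "on_cycle s x"
  shows "place m s (cycle_letter s x) (position s x) = x"
proof (cases x)
  case (Pair t p)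
  then show ?thesis using assms
    by (cases t) (auto simp: valid_stack_def on_cycle_def place_def cycle_letter_def position_def
        split: if_splits)
qed

lemma valid_place:
  assumes "m \<ge> 2" "s = [] \<or> valid_stack m s"
  shows "valid_stack m (fst (place m s c j))"
  using assms by (auto simp: valid_stack_def place_def)

lemma on_cycle_cycle_of: "fst x \<noteq> [] \<Longrightarrow> on_cycle (cycle_of x l) x"
  by (auto simp: on_cycle_def cycle_of_def)

lemma valid_cycle:
  assumes "valid_stack m (fst x)" "on_cycle s x"
  shows "s = [] \<or> valid_stack m s"
proof (cases "fst x")
  case Nil
  then show ?thesis using assms by (simp add: on_cycle_def)
next
  case (Cons i t)
  then show ?thesis using assms by (auto simp: valid_stack_def on_cycle_def split: if_splits)
qed

lemma valid_step:
  assumes "m \<ge> 2" "valid_stack m (fst x)"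
  shows "valid_stack m (fst (step m x l))"
proof -
  have "fst x \<noteq> []" using assms(2) by (auto simp: valid_stack_def)
  then show ?thesis
    using assms valid_cycle[OF assms(2) on_cycle_cycle_of]
    by (simp add: step_def Let_def valid_place)
qed

lemma valid_run: "m \<ge> 2 \<Longrightarrow> valid_stack m (fst x) \<Longrightarrow> valid_stack m (fst (run m x w))"
  by (induction w arbitrary: x) (auto simp: valid_step)

lemma state_as_place:
  assumes "valid_stack m (fst x)"
  obtains s c j where "x = place m s c j" "(a = c) = e" "s = [] \<or> valid_stack m s"
proof -
  let ?s = "cycle_of x (a, e)"
  have ne: "fst x \<noteq> []" using assms by (auto simp: valid_stack_def)
  have "on_cycle ?s x \<and> (a = cycle_letter ?s x) = e"
    using cycle_of_eq_iff[OF ne, of a e ?s] by simp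
  then show ?thesis
    using that place_cycle_view[OF assms, of ?s] valid_cycle[OF assms, of ?s] by metis
qed

lemma step_cancel:
  assumes "valid_stack m (fst x)"
  shows "step m (step m x (a, e)) (a, \<not> e) = x"
proof -
  obtain s c j where "x = place m s c j" and ac: "(a = c) = e"
    using state_as_place[OF assms] by metis
  moreover have "(a = other c) = (\<not> e)" using ac by (cases a; cases c) auto
  ultimately show ?thesis by (simp add: step_place)
qed

lemma run_alternating_place:
  "run m (place m s a j) (alternating a (other a) n) = place m s (twist (int n) a) (j + int n)"
proof (induction n arbitrary: a j)
  case (Suc n)
  have "run m (place m s a j) (alternating a (other a) (Suc n)) =
      run m (place m s (other a) (j + 1)) (alternating (other a) (other (other a)) n)"
    by (simp add: step_place)
  also have "\<dots> = place m s (twist (int n) (other a)) (j + 1 + int n)" by (rule Suc.IH)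
  also have "\<dots> = place m s (twist (int (Suc n)) a) (j + int (Suc n))"
    by (simp add: other_eq_twist algebra_simps)
  finally show ?case .
qed simp

text \<open>An alternating word of length \<open>m\<close> goes once around the cycle of its first letter, whichever
  letter that is; this is why the braid relation holds for the action.\<close>
lemma run_alternating:
  assumes "valid_stack m (fst x)"
  shows "run m x (alternating a (other a) m) = (fst x, twist (int m) (snd x))"
proof -
  obtain s c j where x: "x = place m s c j" and "(a = c) = True"
    using state_as_place[OF assms] by metis
  then have "run m x (alternating a (other a) m) = place m s (twist (int m) c) (j + int m)"
    using run_alternating_place[of m s a j m] by simp
  also have "\<dots> = (fst x, twist (int m) (snd x))"
    by (auto simp: x place_def other_eq_twist ac_simps)
  finally show ?thesis .
qed

definition artin_relators :: "nat \<Rightarrow> (gen gword \<times> gen gword) set" where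
  "artin_relators m = {(alternating Sigma1 Sigma2 m, alternating Sigma2 Sigma1 m)}"

lemma run_word_cong:
  assumes "word_cong (artin_relators m) u v" "m \<ge> 2" "valid_stack m (fst x)"
  shows "run m x u = run m x v"
  using assms
proof (induction arbitrary: x rule: word_cong.induct)
  case (cancel u a e v)
  then show ?case by (simp add: step_cancel valid_run)
next
  case (relator l r u v)
  then have "valid_stack m (fst (run m x u))" by (simp add: valid_run)
  then have "run m (run m x u) l = run m (run m x u) r"
    using relator(1) run_alternating[of m _ Sigma1] run_alternating[of m _ Sigma2]
    by (simp add: artin_relators_def)
  then show ?case by simp
qed simp_all

section \<open>Exponent sums\<close>

definition exponent_sum :: "'a gword \<Rightarrow> int" where
  "exponent_sum w = (\<Sum>l\<leftarrow>w. if snd l then 1 else -1)"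

lemma exponent_sum_append: "exponent_sum (u @ v) = exponent_sum u + exponent_sum v"
  by (simp add: exponent_sum_def)

lemma exponent_sum_alternating: "exponent_sum (alternating a b n) = int n"
  by (induction n arbitrary: a b) (auto simp: exponent_sum_def)

lemma exponent_sum_word_cong:
  "word_cong (artin_relators m) u v \<Longrightarrow> exponent_sum u = exponent_sum v"
proof (induction rule: word_cong.induct)
  case (cancel u a e v)
  then show ?case by (simp add: exponent_sum_append) (simp add: exponent_sum_def)
next
  case (relator l r u v)
  then show ?case by (auto simp: artin_relators_def exponent_sum_append exponent_sum_alternating)
qed simp_all

definition uniform :: "bool \<Rightarrow> 'a gword \<Rightarrow> bool" where
  "uniform e w \<longleftrightarrow> (\<forall>l\<in>set w. snd l = e)"

lemma exponent_sum_uniform: "uniform e w \<Longrightarrow> exponent_sum w = (if e then 1 else -1) * int (length w)"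
  by (induction w) (auto simp: exponent_sum_def uniform_def)

section \<open>Excursions off a cycle\<close>

text \<open>The vertices whose stack ends in \<open>j # s\<close> form the branch attached to the cycle \<open>s\<close> at position
  \<open>j\<close>; one can only enter or leave it along \<open>s\<close>.\<close>

lemma suffix_step:
  assumes "fst x \<noteq> []" "cycle_of x l \<noteq> s"
  shows "suffix (j # s) (fst (step m x l)) \<longleftrightarrow> suffix (j # s) (fst x)"
proof (cases "fst x")
  case (Cons i r)
  then show ?thesis using assms(2)
    by (auto simp: step_def Let_def place_def cycle_of_def suffix_Cons split: if_splits)
qed (use assms in simp)

fun avoids :: "nat \<Rightarrow> int list \<Rightarrow> state \<Rightarrow> gen gword \<Rightarrow> bool" where
  "avoids m s x [] \<longleftrightarrow> True"
| "avoids m s x (l # w) \<longleftrightarrow> cycle_of x l \<noteq> s \<and> avoids m s (step m x l) w"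

lemma suffix_run:
  "fst x \<noteq> [] \<Longrightarrow> avoids m s x w \<Longrightarrow>
    suffix (j # s) (fst (run m x w)) \<longleftrightarrow> suffix (j # s) (fst x)"
  by (induction w arbitrary: x) (auto simp: suffix_step)

text \<open>The tree property: a path that leaves a cycle and comes back to it without a step along it stays
  in a single branch, so it returns to the vertex where it left.\<close>
lemma avoiding_excursion_closed:
  assumes "on_cycle s x" "avoids m s x w" "on_cycle s (run m x w)"
  shows "fst (run m x w) = fst x"
proof -
  have *: "t = t'"
    if "t \<noteq> []" "t' \<noteq> []" "t = s \<or> tl t = s" "t' = s \<or> tl t' = s"
      "\<And>j. suffix (j # s) t \<longleftrightarrow> suffix (j # s) t'" for t t' :: "int list"
    using that(1-4) that(5)[of "hd t"] that(5)[of "hd t'"]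
    by (cases t; cases t') (auto simp: suffix_Cons dest: suffix_length_le)
  show ?thesis
    by (rule *) (use assms suffix_run[OF on_cycle_nonempty[OF assms(1)] assms(2)] in
        \<open>auto simp: on_cycle_def\<close>)
qed

lemma first_move_along:
  obtains "avoids m s x w"
  | u l v where "w = u @ l # v" "avoids m s x u" "cycle_of (run m x u) l = s"
proof (induction w arbitrary: x thesis)
  case (Cons k w)
  show ?case
  proof (cases "cycle_of x k = s")
    case True
    then show ?thesis using Cons.prems(2)[of "[]" k w] by simp
  next
    case False
    show ?thesis
    proof (rule Cons.IH[of "step m x k"])
      assume "avoids m s (step m x k) w"
      then show ?thesis using Cons.prems(1) False by simp
    next
      fix u l v
      assume "w = u @ l # v" "avoids m s (step m x k) u" "cycle_of (run m (step m x k) u) l = s"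
      then show ?thesis using Cons.prems(2)[of "k # u" l v] False by simp
    qed
  qed
qed simp

lemma cycle_letter_step:
  assumes "cycle_of x l = s"
  shows "on_cycle s (step m x l)" "cycle_letter s (step m x l) = other (cycle_letter s x)"
  using assms by (auto simp: step_def Let_def)

section \<open>Closed paths represent powers of \<open>\<Delta>\<close>\<close>

lemma alternating_snoc:
  "alternating a (other a) (Suc n) = alternating a (other a) n @ [(twist (int n) a, True)]"
proof (induction n arbitrary: a)
  case (Suc n)
  have "alternating a (other a) (Suc (Suc n)) =
      (a, True) # alternating (other a) (other (other a)) (Suc n)"
    by simp
  also have "\<dots> = alternating a (other a) (Suc n) @ [(twist (int n) (other a), True)]"
    by (subst Suc.IH) simp
  finally show ?case by (simp add: other_eq_twist add.commute)
qed simp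

text \<open>The braid relation is what makes a closed path represent a power of \<open>\<Delta>\<close>. That, conversely, a
  word of value \<open>\<one>\<close> traces a closed path comes from the presentation.\<close>
locale dihedral_artin = group A for A (structure) +
  fixes \<sigma> :: "gen \<Rightarrow> 'a" and m :: nat
  assumes m_ge: "m \<ge> 2"
    and gen_closed [simp]: "\<sigma> a \<in> carrier A"
    and braid: "word_value A \<sigma> (alternating Sigma1 Sigma2 m) =
      word_value A \<sigma> (alternating Sigma2 Sigma1 m)"
begin

abbreviation val :: "gen gword \<Rightarrow> 'a" where "val \<equiv> word_value A \<sigma>"

lemma val_closed [simp]: "val w \<in> carrier A"
  by (induction w) auto

lemma val_append [simp]: "val (u @ v) = val u \<otimes> val v"
  by (induction u) (auto simp: m_assoc)

definition Delta :: 'a where "Delta = val (alternating Sigma1 Sigma2 m)"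

lemma Delta_closed [simp]: "Delta \<in> carrier A"
  by (simp add: Delta_def)

lemma val_alternating: "val (alternating a (other a) m) = Delta"
  using braid by (cases a) (auto simp: Delta_def)

lemma gen_Delta: "\<sigma> a \<otimes> Delta = Delta \<otimes> \<sigma> (twist (int m) a)"
proof -
  have "\<sigma> a \<otimes> Delta = val (alternating a (other a) (Suc m))"
    using val_alternating[of "other a"] by simp
  also have "\<dots> = Delta \<otimes> \<sigma> (twist (int m) a)"
    by (subst alternating_snoc) (simp add: val_alternating)
  finally show ?thesis .
qed

lemma gen_Delta_pow: "\<sigma> a \<otimes> Delta [^] (k::int) = Delta [^] k \<otimes> \<sigma> (twist (int m * k) a)"
proof (induction k arbitrary: a rule: int_induct[where k = 0])
  case base
  show ?case by simp
next
  case (step1 k)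
  have k: "Delta [^] (k + 1) = Delta [^] k \<otimes> Delta"
    using int_pow_mult[of Delta k 1] by simp
  have "\<sigma> a \<otimes> Delta [^] (k + 1) = (\<sigma> a \<otimes> Delta [^] k) \<otimes> Delta"
    by (simp add: k m_assoc)
  also have "\<dots> = Delta [^] k \<otimes> (\<sigma> (twist (int m * k) a) \<otimes> Delta)"
    by (simp add: step1 m_assoc)
  also have "\<dots> = Delta [^] (k + 1) \<otimes> \<sigma> (twist (int m + int m * k) a)"
    by (simp add: k gen_Delta m_assoc)
  finally show ?case by (simp add: distrib_left add.commute)
next
  case (step2 k)
  have k: "Delta [^] k = Delta [^] (k - 1) \<otimes> Delta"
    using int_pow_mult[of Delta "k - 1" 1] by simp
  have "(\<sigma> a \<otimes> Delta [^] (k - 1)) \<otimes> Delta = \<sigma> a \<otimes> Delta [^] k"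
    by (simp add: k m_assoc)
  also have "\<dots> = Delta [^] k \<otimes> \<sigma> (twist (int m + int m * (k - 1)) a)"
    by (simp add: step2 right_diff_distrib)
  also have "\<dots> = Delta [^] (k - 1) \<otimes> (Delta \<otimes> \<sigma> (twist (int m + int m * (k - 1)) a))"
    by (simp add: k m_assoc)
  also have "\<dots> = (Delta [^] (k - 1) \<otimes> \<sigma> (twist (int m * (k - 1)) a)) \<otimes> Delta"
    using gen_Delta[of "twist (int m * (k - 1)) a"] by (simp add: m_assoc)
  finally show ?case by simp
qed

lemma letter_Delta_pow:
  "val [(a, e)] \<otimes> Delta [^] (k::int) = Delta [^] k \<otimes> val [(twist (int m * k) a, e)]"
proof (cases e)
  case True
  then show ?thesis by (simp add: gen_Delta_pow)
next
  case False
  have "Delta [^] k = inv (\<sigma> a) \<otimes> (\<sigma> a \<otimes> Delta [^] k)"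
    by (simp add: m_assoc[symmetric])
  also have "\<dots> = (inv (\<sigma> a) \<otimes> Delta [^] k) \<otimes> \<sigma> (twist (int m * k) a)"
    by (simp add: gen_Delta_pow m_assoc)
  finally show ?thesis using False by (simp add: inv_solve_right)
qed

text \<open>The element reached after \<open>j\<close> steps from \<open>\<one>\<close> along the cycle on which \<open>c\<close> steps forward, where
  each full turn contributes a factor \<open>\<Delta>\<close> and negative \<open>j\<close> stands for steps backward.\<close>
definition arc :: "gen \<Rightarrow> int \<Rightarrow> 'a" where
  "arc c j = val (alternating c (other c) (nat (j mod int m))) \<otimes> Delta [^] (j div int m)"

lemma arc_closed [simp]: "arc c j \<in> carrier A"
  by (simp add: arc_def)

lemma arc_Suc: "arc c (j + 1) = arc c j \<otimes> \<sigma> (twist j c)"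
proof -
  define n where "n = nat (j mod int m)"
  have n: "int n = j mod int m" "n < m" using m_ge by (auto simp: n_def nat_less_iff)
  have j: "j = int m * (j div int m) + int n" by (simp add: n)
  have "arc c j \<otimes> \<sigma> (twist j c) =
      val (alternating c (other c) n) \<otimes> (Delta [^] (j div int m) \<otimes> \<sigma> (twist (int m * (j div int m)) (twist (int n) c)))"
    using j by (simp add: arc_def n_def m_assoc)
  also have "\<dots> = val (alternating c (other c) (Suc n)) \<otimes> Delta [^] (j div int m)"
    by (subst alternating_snoc, subst gen_Delta_pow[symmetric]) (simp add: m_assoc)
  also have "\<dots> = arc c (j + 1)"
  proof (cases "Suc n = m")
    case True
    then have "j + 1 = int m * (j div int m + 1)" using j by (simp add: algebra_simps)
    then have "(j + 1) mod int m = 0 \<and> (j + 1) div int m = j div int m + 1"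
      using m_ge by simp
    then show ?thesis
      using True int_pow_mult[of Delta 1 "j div int m"]
      by (simp add: arc_def val_alternating add.commute del: alternating.simps(2))
  next
    case False
    then have "int (Suc n) < int m" "j + 1 = int (Suc n) + (j div int m) * int m" using n j by auto
    then have "(j + 1) mod int m = int (Suc n) \<and> (j + 1) div int m = j div int m"
      by (metis add.commute div_mult_self1 div_pos_pos_trivial mod_mult_self1 mod_pos_pos_trivial
          of_nat_0_le_iff add.right_neutral linorder_not_less of_nat_less_0_iff)
    then show ?thesis by (simp only: arc_def nat_int)
  qed
  finally show ?thesis by simp
qed

text \<open>The base letter of a stack \<open>t\<close> is the generator that steps forward along \<open>tl t\<close> from the normal
  form of \<open>t\<close>. The value at \<open>[]\<close> is chosen so that the root cycle starts with \<open>Sigma1\<close>.\<close>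
fun normal_form :: "int list \<Rightarrow> 'a" and
  base_letter :: "int list \<Rightarrow> gen" where
  "normal_form [] = \<one>"
| "normal_form (i # s) = normal_form s \<otimes> arc (other (base_letter s)) i"
| "base_letter [] = Sigma2"
| "base_letter (i # s) = twist i (other (base_letter s))"

lemma normal_form_closed [simp]: "normal_form t \<in> carrier A"
  by (induction t) auto

text \<open>The elements located at a vertex are those of a coset of \<open>\<langle>\<Delta>\<rangle>\<close>; the exponent of \<open>\<Delta>\<close>
  determines how far the letters are exchanged with respect to the normal form.\<close>
definition located :: "'a \<Rightarrow> state \<Rightarrow> bool" where
  "located g x \<longleftrightarrow> valid_stack m (fst x) \<and>
    (\<exists>k::int. g = normal_form (fst x) \<otimes> Delta [^] k \<and> snd x = twist (int m * k) (base_letter (fst x)))"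

lemma arc_mod: "arc c j = arc c (j mod int m) \<otimes> Delta [^] (j div int m)"
  using m_ge by (simp add: arc_def)

lemma arc_0 [simp]: "arc c 0 = \<one>"
  by (simp add: arc_def)

text \<open>In terms of positions on a cycle, the elements located at a state are described by one formula,
  with the turns around the cycle absorbed in the exponent of \<open>\<Delta>\<close>.\<close>
lemma located_place:
  assumes s: "s = [] \<or> valid_stack m s"
  shows "located g (place m s c j) \<longleftrightarrow>
    (\<exists>k::int. g = normal_form s \<otimes> arc (other (base_letter s)) j \<otimes> Delta [^] k
      \<and> c = twist (int m * k + j) (other (base_letter s)))" (is "_ \<longleftrightarrow> (\<exists>k. ?P k)")
proof -
  let ?d = "j div int m"
  have j: "j = int m * ?d + j mod int m" by simp
  have *: "located g (place m s c j) \<longleftrightarrow> (\<exists>k. ?P (k - ?d))"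
  proof -
    have "?P (k - ?d) \<longleftrightarrow> g = normal_form (fst (place m s c j)) \<otimes> Delta [^] k \<and>
        snd (place m s c j) = twist (int m * k) (base_letter (fst (place m s c j)))" for k
    proof -
      have "arc c' j \<otimes> Delta [^] (k - ?d) = arc c' (j mod int m) \<otimes> Delta [^] k" for c'
        by (subst arc_mod) (simp add: m_assoc int_pow_mult[symmetric])
      moreover have "int m * (k - ?d) + j = int m * k + j mod int m"
        by (subst (2) j) (simp add: algebra_simps)
      ultimately show ?thesis
        by (auto simp: place_def m_assoc other_eq_twist intro!: twist_cong)
           (auto simp: twist_def other_eq_iff)
    qed
    then show ?thesis using valid_place[OF m_ge s] by (simp add: located_def)
  qed
  also have "\<dots> \<longleftrightarrow> (\<exists>k. ?P k)" by (metis add_diff_cancel_right')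
  finally show ?thesis .
qed

lemma located_step:
  assumes "located g x"
  shows "located (g \<otimes> val [l]) (step m x l)"
proof -
  obtain a e where l: "l = (a, e)" by (cases l)
  have "valid_stack m (fst x)" using assms by (simp add: located_def)
  then obtain s c j where x: "x = place m s c j" and ac: "(a = c) = e"
    and s: "s = [] \<or> valid_stack m s"
    using state_as_place by metis
  let ?b = "other (base_letter s)"
  obtain k :: int where k: "g = normal_form s \<otimes> arc ?b j \<otimes> Delta [^] k" "c = twist (int m * k + j) ?b"
    using assms located_place[OF s] x by auto
  show ?thesis
  proof (cases e)
    case True
    then have a: "a = twist (int m * k) (twist j ?b)" using ac k by simp
    have "g \<otimes> val [l] = normal_form s \<otimes> (arc ?b j \<otimes> \<sigma> (twist j ?b)) \<otimes> Delta [^] k"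
      using True by (simp add: l k(1) m_assoc) (simp add: a gen_Delta_pow)
    also have "\<dots> = normal_form s \<otimes> arc ?b (j + 1) \<otimes> Delta [^] k"
      by (simp add: arc_Suc)
    finally show ?thesis using True ac
      by (auto simp: l x step_place located_place[OF s] k(2) other_eq_twist intro!: exI[of _ k] twist_cong)
  next
    case False
    then have "a = other c" using ac neq_iff_other by auto
    then have a: "a = twist (int m * k) (twist (j - 1) ?b)"
      using k by (auto simp: other_eq_twist intro!: twist_cong)
    have "g = normal_form s \<otimes> (arc ?b (j - 1) \<otimes> \<sigma> (twist (j - 1) ?b)) \<otimes> Delta [^] k"
      using arc_Suc[of ?b "j - 1"] by (simp add: k(1))
    also have "\<dots> = normal_form s \<otimes> arc ?b (j - 1) \<otimes> Delta [^] k \<otimes> \<sigma> a"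
      by (simp add: m_assoc a gen_Delta_pow)
    finally have "g \<otimes> val [l] = normal_form s \<otimes> arc ?b (j - 1) \<otimes> Delta [^] k"
      using False by (simp add: l m_assoc)
    then show ?thesis using False ac
      by (auto simp: l x step_place located_place[OF s] k(2) other_eq_twist intro!: exI[of _ k] twist_cong)
  qed
qed

lemma located_carrier: "located g x \<Longrightarrow> g \<in> carrier A"
  by (auto simp: located_def)

lemma located_nonempty: "located g x \<Longrightarrow> fst x \<noteq> []"
  by (auto simp: located_def valid_stack_def)

lemma located_run: "located g x \<Longrightarrow> located (g \<otimes> val w) (run m x w)"
proof (induction w arbitrary: g x)
  case Nil
  then show ?case by (simp add: located_carrier)
next
  case (Cons l w)
  show ?case
    using Cons.IH[OF located_step[OF Cons.prems, of l]] located_carrier[OF Cons.prems]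
    by (cases l) (simp add: m_assoc)
qed

text \<open>The initial and the final element lie in the same coset of \<open>\<langle>\<Delta>\<rangle>\<close>, and the final letter records
  whether the power of \<open>\<Delta>\<close> by which they differ exchanges the generators.\<close>
lemma closed_val:
  assumes "located g x" "fst (run m x w) = fst x"
  obtains k :: int where "val w = Delta [^] k" "snd (run m x w) = twist (int m * k) (snd x)"
proof -
  let ?t = "fst x"
  obtain i :: int where i: "g = normal_form ?t \<otimes> Delta [^] i" "snd x = twist (int m * i) (base_letter ?t)"
    using assms by (auto simp: located_def)
  obtain j :: int where j: "g \<otimes> val w = normal_form ?t \<otimes> Delta [^] j"
      "snd (run m x w) = twist (int m * j) (base_letter ?t)"
    using located_run[OF assms(1), of w] assms(2) by (auto simp: located_def)
  have "Delta [^] i \<otimes> val w = Delta [^] i \<otimes> Delta [^] (j - i)"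
    using i(1) j(1) by (simp add: m_assoc int_pow_mult[symmetric])
  then have "val w = Delta [^] (j - i)" by simp
  moreover have "snd (run m x w) = twist (int m * (j - i)) (snd x)"
    by (simp add: i j algebra_simps)
  ultimately show ?thesis by (rule that)
qed

section \<open>Signs of closed paths without removable pairs\<close>

definition removable_free :: "gen gword \<Rightarrow> bool" where
  "removable_free w \<longleftrightarrow> \<not> contains_removable_pair A \<sigma> w"

lemma removable_free_sublist: "removable_free w \<Longrightarrow> sublist v w \<Longrightarrow> removable_free v"
  by (auto simp: removable_free_def contains_removable_pair_def intro: sublist_order.order_trans)

lemma removable_freeD: "removable_free w \<Longrightarrow> sublist ((a, e) # u @ [(b, \<not> e)]) w \<Longrightarrow>
   val ((a, e) # u @ [(b, \<not> e)]) \<noteq> val u"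
  by (fastforce simp: removable_free_def contains_removable_pair_def removable_pair_def)

lemma letter_cancel: "val [(a, e)] \<otimes> val [(a, \<not> e)] = \<one>"
  by simp

lemma val_Cons: "val (l # w) = val [l] \<otimes> val w"
  by (cases l) simp

text \<open>If the excursion \<open>u\<close> has value \<open>\<Delta>\<close> to the power \<open>k\<close> and \<open>l'\<close> has the sign opposite to \<open>l\<close>, then
  \<open>l'\<close> runs back along the edge of \<open>l\<close>, so that \<open>l'\<close> is the inverse of the conjugate of \<open>l\<close> by this
  power, and \<open>l u l'\<close> has the value of \<open>u\<close>.\<close>
lemma no_backtrack:
  assumes loc: "located g x" and free: "removable_free (l # u @ [l'])"
    and cyc: "cycle_of x l = s" "cycle_of (run m (step m x l) u) l' = s"
    and closed: "fst (run m (step m x l) u) = fst (step m x l)"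
  shows "snd l' = snd l"
proof (rule ccontr)
  assume neq: "snd l' \<noteq> snd l"
  obtain a e where l: "l = (a, e)" by (cases l)
  with neq obtain b where l': "l' = (b, \<not> e)" by (cases l') auto
  let ?y = "step m x l" and ?z = "run m (step m x l) u"
  obtain k :: int where k: "val u = Delta [^] k" "snd ?z = twist (int m * k) (snd ?y)"
    using closed_val[OF located_step[OF loc] closed] by metis
  have "cycle_letter s ?z = twist (int m * k) (cycle_letter s ?y)"
    using closed k by (simp add: cycle_letter_def other_eq_twist add.commute)
  then have z: "cycle_letter s ?z = other (twist (int m * k) (cycle_letter s x))"
    by (simp add: cycle_letter_step(2)[OF cyc(1)] other_eq_twist add.commute)
  have "(a = cycle_letter s x) = e" "(b = cycle_letter s ?z) = (\<not> e)"
    using cyc cycle_of_eq_iff[OF located_nonempty[OF loc]] cycle_of_eq_iff[of ?z] closed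
    by (auto simp: l l')
  then have "(a = cycle_letter s x) = (b = twist (int m * k) (cycle_letter s x))"
    using neq_iff_other z by metis
  then have b: "b = twist (int m * k) a" 
    by (rule same_side_twist)
  have "val (l # u @ [l']) = (val [l] \<otimes> Delta [^] k) \<otimes> val [l']"
    using val_Cons[of l "u @ [l']"] by (simp add: k m_assoc)
  also have "\<dots> = val u \<otimes> (val [(b, e)] \<otimes> val [(b, \<not> e)])"
    unfolding l letter_Delta_pow b[symmetric] k l' by (simp add: m_assoc)
  also have "\<dots> = val u" by (subst letter_cancel) simp
  finally show False using removable_freeD[OF free, of a e u b] by (simp add: l l')
qed

text \<open>Here \<open>l u\<close> is the closed word, of value \<open>\<Delta>\<close> to the power \<open>k\<close>. A negative step along one
  cycle at a vertex is the inverse of the generator that steps forward along the other one. So if \<open>l'\<close>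
  has the opposite sign and runs along the other cycle, it is the inverse of \<open>l\<close> up to conjugation by
  that power, and both \<open>u\<close> and \<open>l u l'\<close> have the value \<open>l\<inverse> \<Delta>\<^sup>k\<close>.\<close>
lemma no_turn_across:
  assumes loc: "located g x" and free: "removable_free (l # u @ [l'])"
    and cyc: "cycle_of (run m x (l # u)) l' \<noteq> cycle_of x l"
    and closed: "fst (run m x (l # u)) = fst x"
  shows "snd l' = snd l"
proof (rule ccontr)
  assume neq: "snd l' \<noteq> snd l"
  obtain a e where l: "l = (a, e)" by (cases l)
  with neq obtain b where l': "l' = (b, \<not> e)" by (cases l') auto
  let ?z = "run m x (l # u)"
  obtain k :: int where k: "val (l # u) = Delta [^] k" "snd ?z = twist (int m * k) (snd x)"
    using closed_val[OF loc closed] by metis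
  have "(a = snd x) = (b = twist (int m * k) (snd x))"
    using cyc closed k(2) by (auto simp: cycle_of_def l l' split: if_splits)
  then have b: "b = twist (int m * k) a" 
    by (rule same_side_twist)
  have "val u = (val [(a, \<not> e)] \<otimes> val [l]) \<otimes> val u"
    by (cases e) (simp_all add: l)
  also have "\<dots> = val [(a, \<not> e)] \<otimes> Delta [^] k"
    using k(1) val_Cons[of l u] by (simp add: m_assoc del: word_value.simps)
  finally have u: "val u = val [(a, \<not> e)] \<otimes> Delta [^] k" .
  have "val (l # u @ [l']) = Delta [^] k \<otimes> val [l']"
    using k(1) val_append[of "l # u" "[l']"] by simp
  also have "\<dots> = val u" by (simp only: u letter_Delta_pow l' b)
  finally show False using removable_freeD[OF free, of a e u b] by (simp add: l l')
qed

text \<open>The induction hypothesis of \<open>closed_removable_free_uniform\<close> enters as the last assumption. The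
  word \<open>u1\<close> runs through the last step along \<open>s\<close>; all excursions before that step are compared with
  the step along \<open>s\<close> following them. The final excursion \<open>u2\<close> has no such step after it and is
  treated in \<open>closed_removable_free_uniform\<close>.\<close>
lemma along_cycle_decomposition:
  assumes "located g x" "cycle_of x l = s" "removable_free (l # u)"
    and "on_cycle s (run m (step m x l) u)"
    and IH: "\<And>v g y. length v \<le> length u \<Longrightarrow> located g y \<Longrightarrow> removable_free v \<Longrightarrow>
      fst (run m y v) = fst y \<Longrightarrow> \<exists>e. uniform e v"
  shows "\<exists>u1 u2. u = u1 @ u2 \<and> uniform (snd l) u1 \<and> avoids m s (run m (step m x l) u1) u2 \<and>
    fst (run m (step m x l) u) = fst (run m (step m x l) u1)"
  using assms
proof (induction "length u" arbitrary: g x l u rule: less_induct)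
  case less
  note loc = less.prems(1) and cyc = less.prems(2) and free = less.prems(3)
    and fin = less.prems(4) and IH = less.prems(5)
  let ?y = "step m x l"
  have on: "on_cycle s ?y" using cycle_letter_step(1)[OF cyc] .
  show ?case
  proof (rule first_move_along[of m s ?y u])
    assume "avoids m s ?y u"
    with avoiding_excursion_closed[OF on this fin] show ?thesis
      by (intro exI[of _ "[]"] exI[of _ u]) (simp add: uniform_def)
  next
    fix v l' w
    assume u: "u = v @ l' # w" and av: "avoids m s ?y v" and cyc': "cycle_of (run m ?y v) l' = s"
    let ?z = "run m ?y v"
    have onz: "on_cycle s ?z"
      using on_cycle_cycle_of[of ?z l'] cyc' by (simp add: nonempty_run)
    then have closed: "fst ?z = fst ?y" using avoiding_excursion_closed[OF on av] by simp
    have sub: "removable_free (l # v @ [l'])" "removable_free (v @ [l'])" "removable_free v"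
      "removable_free (l' # w)"
    proof -
      have "sublist (l # v @ [l']) (l # u)" 
        using sublist_appendI[of "l # v @ [l']" "[]" w] by (simp add: u)
      moreover have "sublist (v @ [l']) (l # u)" 
        using sublist_appendI[of "v @ [l']" "[l]" w] by (simp add: u)
      moreover have "sublist v (l # u)" 
        using sublist_appendI[of v "[l]" "l' # w"] by (simp add: u)
      moreover have "sublist (l' # w) (l # u)" 
        using sublist_appendI[of "l' # w" "l # v" "[]"] by (simp add: u)
      ultimately show "removable_free (l # v @ [l'])" "removable_free (v @ [l'])" "removable_free v"
        "removable_free (l' # w)"
        using free removable_free_sublist by blast+
    qed
    have sign: "snd l' = snd l"
      by (rule no_backtrack[OF loc sub(1) cyc cyc' closed])
    note locy = located_step[OF loc, of l]
    \<comment> \<open>The excursion \<open>v\<close> leaves along the cycle other than \<open>s\<close>, and \<open>l'\<close> follows along \<open>s\<close>.\<close>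
    have "uniform (snd l) v"
    proof (cases v)
      case (Cons k v')
      obtain e where e: "uniform e v" using IH[OF _ locy sub(3) closed] u by auto
      have "cycle_of ?y k \<noteq> s" using av Cons by simp
      then have "snd l' = snd k"
        using no_turn_across[OF locy, of k v' l'] sub(2) cyc' closed Cons by simp
      then show ?thesis using e sign Cons by (simp add: uniform_def)
    qed (simp add: uniform_def)
    moreover have "\<exists>u1 u2. w = u1 @ u2 \<and> uniform (snd l') u1 \<and>
        avoids m s (run m (step m ?z l') u1) u2 \<and>
        fst (run m (step m ?z l') w) = fst (run m (step m ?z l') u1)"
    proof (rule less.hyps[OF _ located_run[OF locy] cyc' sub(4)])
      show "length w < length u" by (simp add: u)
      show "on_cycle s (run m (step m ?z l') w)" using fin by (simp add: u)
      show "\<exists>e. uniform e v'" if "length v' \<le> length w" "located g' y" "removable_free v'"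
        "fst (run m y v') = fst y" for v' g' y
        using IH[OF _ that(2-4)] that(1) u by simp
    qed
    then obtain u1 u2 where "w = u1 @ u2" "uniform (snd l') u1"
      "avoids m s (run m (step m ?z l') u1) u2"
      "fst (run m (step m ?z l') w) = fst (run m (step m ?z l') u1)"
      by blast
    ultimately show ?thesis
      by (intro exI[of _ "v @ l' # u1"] exI[of _ u2]) (auto simp: u sign uniform_def)
  qed
qed

theorem closed_removable_free_uniform:
  assumes "located g x" "removable_free w" "fst (run m x w) = fst x"
  shows "\<exists>e. uniform e w"
  using assms
proof (induction "length w" arbitrary: g x w rule: less_induct)
  case less
  note loc = less.prems(1) and free = less.prems(2) and closed = less.prems(3)
  show ?case
  proof (cases w)
    case (Cons l u)
    let ?s = "cycle_of x l" and ?y = "step m x l"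
    have "on_cycle ?s (run m ?y u)"
      using closed Cons on_cycle_cycle_of[OF located_nonempty[OF loc], of l]
      by (simp add: on_cycle_def)
    then obtain u1 u2 where u: "u = u1 @ u2" and u1: "uniform (snd l) u1"
      and av: "avoids m ?s (run m ?y u1) u2" and eq: "fst (run m ?y u) = fst (run m ?y u1)"
      using along_cycle_decomposition[OF loc HOL.refl, of l u] free less.hyps Cons
      by (metis le_imp_less_Suc length_Cons)
    have c1: "fst (run m x (l # u1)) = fst x" using eq closed Cons by simp
    \<comment> \<open>The last excursion is compared with the step \<open>l\<close>: the word \<open>l # u1\<close> is itself closed at its vertex.\<close>
    have "uniform (snd l) u2"
    proof (cases u2)
      case (Cons l' v)
      have "sublist (l # u1 @ [l']) w"
        using sublist_appendI[of "l # u1 @ [l']" "[]" v] by (simp add: u Cons \<open>w = l # u\<close>)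
      then have "snd l' = snd l"
        using no_turn_across[OF loc _ _ c1, of l'] removable_free_sublist[OF free] av Cons by simp
      moreover have "sublist u2 w"
        using sublist_appendI[of u2 "l # u1" "[]"] by (simp add: u \<open>w = l # u\<close>)
      then have "\<exists>e. uniform e u2"
        using less.hyps[of u2 _ "run m ?y u1"] located_run[OF located_step[OF loc, of l], of u1]
          removable_free_sublist[OF free] eq u \<open>w = l # u\<close> by simp
      ultimately show ?thesis by (auto simp: uniform_def Cons)
    qed (simp add: uniform_def)
    with u1 show ?thesis by (auto simp: uniform_def Cons u)
  qed (simp add: uniform_def)
qed

end

section \<open>From the presentation to the group\<close>

lemma iso_word_class:
  assumes "group G" and iso: "\<phi> \<in> iso (presented_group R) G"
    and gen: "\<And>a. \<phi> (word_class R [(a, True)]) = s a"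
  shows "\<phi> (word_class R w) = word_value G s w"
proof -
  let ?P = "presented_group R"
  interpret P: group ?P by (rule group_presented_group)
  interpret G: group G by fact
  interpret group_hom ?P G \<phi>
    using iso by unfold_locales (simp add: iso_def)
  have carr: "word_class R u \<in> carrier ?P" for u
    by (simp add: presented_group_def)
  have one: "word_class R [] = \<one>\<^bsub>?P\<^esub>" by (simp add: presented_group_def)
  have "word_class R [(a, False)] = inv\<^bsub>?P\<^esub> word_class R [(a, True)]" for a
  proof -
    have "word_class R [(a, False)] \<otimes>\<^bsub>?P\<^esub> word_class R [(a, True)] = \<one>\<^bsub>?P\<^esub>"
      using word_cong.cancel[of R "[]" a False "[]"]
      by (simp add: presented_group_mult one[symmetric] word_class_eq_iff)
    then show ?thesis using P.inv_equality carr by metis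
  qed
  then have letter: "\<phi> (word_class R [(a, e)]) = (if e then s a else inv\<^bsub>G\<^esub> (s a))" for a e
    by (simp add: gen carr)
  show ?thesis
  proof (induction w)
    case Nil
    show ?case by (simp add: one)
  next
    case (Cons l w)
    obtain a e where l: "l = (a, e)" by (cases l)
    have "\<phi> (word_class R (l # w)) = \<phi> (word_class R [l] \<otimes>\<^bsub>?P\<^esub> word_class R w)"
      by (simp add: presented_group_mult)
    also have "\<dots> = word_value G s (l # w)"
      by (simp add: carr Cons letter l)
    finally show ?case .
  qed
qed

lemma word_value_eq_iff:
  assumes "admits_presentation G s R"
  shows "word_value G s u = word_value G s v \<longleftrightarrow> word_cong R u v"
proof -
  obtain \<phi> where "group G" and iso: "\<phi> \<in> iso (presented_group R) G"
    and gen: "\<And>a. \<phi> (word_class R [(a, True)]) = s a"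
    using assms by (auto simp: admits_presentation_def)
  note value_word = iso_word_class[OF this, symmetric]
  have "inj_on \<phi> (carrier (presented_group R))" using iso by (simp add: iso_def bij_betw_def)
  then have "\<phi> (word_class R u) = \<phi> (word_class R v) \<longleftrightarrow> word_class R u = word_class R v"
    by (rule inj_on_eq_iff) (simp_all add: presented_group_def)
  then show ?thesis by (simp add: value_word word_class_eq_iff)
qed

lemma presentation_gen_closed:
  assumes "admits_presentation G s R"
  shows "s a \<in> carrier G"
proof -
  obtain \<phi> where "\<phi> \<in> iso (presented_group R) G" "\<phi> (word_class R [(a, True)]) = s a"
    using assms by (auto simp: admits_presentation_def)
  moreover have "word_class R [(a, True)] \<in> carrier (presented_group R)"
    by (simp add: presented_group_def)
  ultimately show ?thesis by (auto simp: iso_def dest: hom_in_carrier)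
qed

theorem proposition5p1:
  fixes m :: nat
    and A :: "('g, 'b) monoid_scheme"
    and \<sigma> :: "gen \<Rightarrow> 'g"
    and w :: "gen gword"
  assumes "m \<ge> 2"
    and "artin_tits_I2 m A \<sigma>"
    and "w \<noteq> []"
    and "word_value A \<sigma> w = \<one>\<^bsub>A\<^esub>"
  shows "contains_removable_pair A \<sigma> w"
proof (rule ccontr)
  assume no_pair: "\<not> contains_removable_pair A \<sigma> w"
  have pres: "admits_presentation A \<sigma> (artin_relators m)"
    using assms(2) by (simp add: artin_tits_I2_def artin_relators_def)
  interpret group A using pres by (simp add: admits_presentation_def)
  interpret dihedral_artin A \<sigma> m
  proof
    have "word_cong (artin_relators m) (alternating Sigma1 Sigma2 m) (alternating Sigma2 Sigma1 m)"
      using word_cong.relator[of _ _ "artin_relators m" "[]" "[]"] by (simp add: artin_relators_def)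
    then show "word_value A \<sigma> (alternating Sigma1 Sigma2 m) =
        word_value A \<sigma> (alternating Sigma2 Sigma1 m)"
      by (simp add: word_value_eq_iff[OF pres])
  qed (use assms(1) presentation_gen_closed[OF pres] in auto)
  let ?x = "([0], Sigma1)"
  have trivial: "word_cong (artin_relators m) w []"
    using assms(4) by (simp add: word_value_eq_iff[OF pres, symmetric])
  have valid: "valid_stack m (fst ?x)" using assms(1) by (simp add: valid_stack_def)
  then have "located \<one>\<^bsub>A\<^esub> ?x" by (auto simp: located_def intro!: exI[of _ 0])
  moreover have "run m ?x w = ?x"
    using run_word_cong[OF trivial assms(1) valid] by simp
  ultimately obtain e where "uniform e w"
    using closed_removable_free_uniform[of "\<one>\<^bsub>A\<^esub>" ?x w] no_pair by (auto simp: removable_free_def)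
  moreover have "exponent_sum w = 0"
    using exponent_sum_word_cong[OF trivial] by (simp add: exponent_sum_def)
  ultimately show False using assms(3) exponent_sum_uniform[of e w] by (auto split: if_splits)
qed

end
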